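(* Let $F$ be a (plane) forest of size $n$. Then $$\sum_{(F,w)\in B_n(F)}q^{\mathrm{inv}_B(F,w)}=\frac{n!}{\prod_{u\in F}h_u}\prod_{u\in F}[2h_u].$$
   Context: Notation: $[1,n]=\{1,\dots,n\}$, and for a nonnegative integer $m$, $[m]=1+q+\cdots+q^{m-1}$. A forest $F$ is a (plane) rooted forest with vertex set $V(F)$; being plane, its vertices are regarded as distinguishable (implicitly labeled). Its size is the number of vertices. $F$ is regarded as a poset with the roots at the top: $v\le_F u$ iff $u$ lies on the path from $v$ to the root of its tree. The hook length $h_u$ of a vertex $u$ is the number of vertices of the subtree rooted at $u$, i.e. $h_u=|\{v\in F: v\le_F u\}|$. A signed labeling of a forest $F$ of size $n$ is a map $w:V(F)\to\{\pm1,\dots,\pm n\}$ such that $u\mapsto|w(u)|$ is a bijection from $V(F)$ to $[1,n]$. $B_n(F)$ denotes the set of all signed labeled forests $(F,w)$ with underlying forest $F$, i.e. the set of all signed labelings of $F$. Labels are compared in the natural order of the integers. For $(F,w)\in B_n(F)$ define - $\mathrm{inv}(F,w)=|\{(u,v): u>_F v,\ w(u)<w(v)\}|$; - $\mathrm{n}_1(F,w)=$ the number of negative labels of $w$; - $\mathrm{n}_2(F,w)=|\{(u,v): u<_F v,\ w(u)+w(v)<0\}|$; - $\mathrm{inv}_B(F,w)=\mathrm{inv}(F,w)+\mathrm{n}_1(F,w)+\mathrm{n}_2(F,w)$. *)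

theory Defs
  imports Complex_Main "HOL-Library.FuncSet" "HOL-Library.Sublist"
begin

datatype plane_tree = Node (subtrees: "plane_tree list")

type_synonym plane_forest = "plane_tree list"

text \<open>
  Vertices are addressed by nonempty lists of positions: \<open>[i]\<close> is the root of the \<open>i\<close>-th tree,
  and \<open>i # p\<close> with \<open>p\<close> nonempty is the vertex with address \<open>p\<close> in the forest obtained from the
  \<open>i\<close>-th tree by deleting its root. The parent of a non-root vertex \<open>p\<close> is thus \<open>butlast p\<close>.
\<close>

fun is_vertex :: "plane_forest \<Rightarrow> nat list \<Rightarrow> bool" where
  "is_vertex F [] = False"
| "is_vertex F (i # p) = (i < length F \<and> (p = [] \<or> is_vertex (subtrees (F ! i)) p))"

definition vertices :: "plane_forest \<Rightarrow> nat list set" where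
  "vertices F = {p. is_vertex F p}"

definition forest_size :: "plane_forest \<Rightarrow> nat" where
  "forest_size F = card (vertices F)"

text \<open>
  The path from \<open>v\<close> to the root of its tree consists of the nonempty prefixes of the address \<open>v\<close>.
\<close>

definition forest_le :: "plane_forest \<Rightarrow> nat list \<Rightarrow> nat list \<Rightarrow> bool" where
  "forest_le F v u \<longleftrightarrow> v \<in> vertices F \<and> u \<in> vertices F \<and> prefix u v"

definition forest_less :: "plane_forest \<Rightarrow> nat list \<Rightarrow> nat list \<Rightarrow> bool" where
  "forest_less F v u \<longleftrightarrow> forest_le F v u \<and> v \<noteq> u"

definition hook_length :: "plane_forest \<Rightarrow> nat list \<Rightarrow> nat" where
  "hook_length F u = card {v \<in> vertices F. forest_le F v u}"

text \<open>
  The extensional function space makes labelings that agree on all vertices equal, so that each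
  signed labeling is counted once.
\<close>

definition signed_labelings :: "plane_forest \<Rightarrow> (nat list \<Rightarrow> int) set" where
  "signed_labelings F =
     {w \<in> vertices F \<rightarrow>\<^sub>E ({- int (forest_size F)..int (forest_size F)} - {0}).
        bij_betw (\<lambda>u. \<bar>w u\<bar>) (vertices F) {1..int (forest_size F)}}"

definition inv_stat :: "plane_forest \<Rightarrow> (nat list \<Rightarrow> int) \<Rightarrow> nat" where
  "inv_stat F w = card {(u, v). forest_less F v u \<and> w u < w v}"

definition n1_stat :: "plane_forest \<Rightarrow> (nat list \<Rightarrow> int) \<Rightarrow> nat" where
  "n1_stat F w = card {u \<in> vertices F. w u < 0}"

definition n2_stat :: "plane_forest \<Rightarrow> (nat list \<Rightarrow> int) \<Rightarrow> nat" where
  "n2_stat F w = card {(u, v). forest_less F u v \<and> w u + w v < 0}"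

definition invB_stat :: "plane_forest \<Rightarrow> (nat list \<Rightarrow> int) \<Rightarrow> nat" where
  "invB_stat F w = inv_stat F w + n1_stat F w + n2_stat F w"

definition q_int :: "'a::comm_semiring_1 \<Rightarrow> nat \<Rightarrow> 'a" where
  "q_int q m = (\<Sum>i<m. q ^ i)"

lemma vertices_Nil: "vertices [] = {}"
proof -
  have "\<not> is_vertex [] p" for p by (cases p) auto
  then show ?thesis by (simp add: vertices_def)
qed

lemma vertices_eq:
  "vertices F = (\<Union>i<length F. insert [i] ((#) i ` vertices (subtrees (F ! i))))"
proof (rule set_eqI)
  fix p
  show "p \<in> vertices F \<longleftrightarrow>
      p \<in> (\<Union>i<length F. insert [i] ((#) i ` vertices (subtrees (F ! i))))"
    by (cases p) (auto simp: vertices_def)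
qed

lemma finite_vertices: "finite (vertices F)"
proof -
  have tree: "finite (vertices (subtrees t))" for t
  proof (induction t)
    case (Node ts)
    have "finite (vertices ts)"
      by (subst vertices_eq) (auto intro!: Node)
    then show ?case by simp
  qed
  show ?thesis by (subst vertices_eq) (auto simp: tree)
qed

end

theory Submission
  imports Defs
begin

text \<open>
  Charge every inversion-type contribution to the upper vertex involved. For comparable vertices
  \<open>v < u\<close> the pair contributes \<open>[w u < w v] + [w u < - w v]\<close>, and a negative label contributes
  \<open>[w u < - w u]\<close>. So if \<open>D u\<close> is the subtree rooted at \<open>u\<close>, then the total charge of \<open>u\<close> is the
  number of elements larger than \<open>w u\<close> in the set of all \<open>\<plusminus> w v\<close>, \<open>v \<in> D u\<close>, which has \<open>2 h\<^sub>u\<close>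
  elements; that is, the charge is the rank of \<open>w u\<close> in this set, counted from the top
  (\<open>invB_stat_eq_sum_charge\<close>).

  Only the relative order of the labels of the subtree matters for these ranks, so it is natural to
  allow an arbitrary set \<open>S\<close> of positive integers as the set of absolute values, and to show that the
  generating function depends on the cardinality of \<open>S\<close> only (\<open>charge_generating_function\<close>). A single
  tree is handled by removing its root \<open>r\<close>: the label of \<open>r\<close> is any of the \<open>2 h\<^sub>r\<close> elements of
  \<open>S \<union> -S\<close>, each rank occurs exactly once, and the remaining labels form an independent labeling of
  the smaller forest, whence the factor \<open>[2 h\<^sub>r]\<close>. A forest that is not a single tree is the disjoint
  union of one of its trees and the rest; distributing the absolute values over the two parts gives
  a binomial coefficient, which turns the product of the two factorials into \<open>n!\<close>.

  The induction never uses the addresses of the vertices. It runs over an arbitrary finite set with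
  a suitable family of subtrees, so that parts of a forest are again instances without renaming.
\<close>

section \<open>Ranks in a finite linear order\<close>

text \<open>
  The ranks of the elements of a finite linear order, counted from the top, are
  \<open>0, \<dots>, card A - 1\<close>; a new minimum gets rank \<open>card A\<close> and changes no other rank.
\<close>

lemma sum_power_rank:
  fixes A :: "'b::linorder set" and q :: "'a::comm_semiring_1"
  assumes "finite A"
  shows "(\<Sum>x\<in>A. q ^ card {y \<in> A. x < y}) = q_int q (card A)"
  using assms
proof (induction rule: finite_linorder_min_induct)
  case empty
  then show ?case by (simp add: q_int_def)
next
  case (insert b A)
  have new: "{y \<in> insert b A. b < y} = A"
    using insert.hyps by auto
  have old: "{y \<in> insert b A. x < y} = {y \<in> A. x < y}" if "x \<in> A" for x
    using insert.hyps that by force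
  have "b \<notin> A"
    using insert.hyps by auto
  then have "(\<Sum>x\<in>insert b A. q ^ card {y \<in> insert b A. x < y}) =
      q ^ card A + (\<Sum>x\<in>A. q ^ card {y \<in> A. x < y})"
    using insert.hyps(1) by (simp only: sum.insert new old not_False_eq_True cong: sum.cong)
  then show ?case
    using insert \<open>b \<notin> A\<close> by (simp add: q_int_def add.commute)
qed

section \<open>Signed labelings with prescribed absolute values\<close>

definition labelings :: "'v set \<Rightarrow> int set \<Rightarrow> ('v \<Rightarrow> int) set" where
  "labelings V S = {w \<in> extensional V. bij_betw (\<lambda>u. \<bar>w u\<bar>) V S}"

definition signed_values :: "int set \<Rightarrow> int set" where
  "signed_values S = S \<union> uminus ` S"

lemma signed_values_iff: "S \<subseteq> {0<..} \<Longrightarrow> x \<in> signed_values S \<longleftrightarrow> \<bar>x\<bar> \<in> S"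
  unfolding signed_values_def
  by (cases "0 \<le> x") (force simp: image_iff)+

lemma finite_signed_values: "finite S \<Longrightarrow> finite (signed_values S)"
  by (simp add: signed_values_def)

lemma card_signed_values:
  assumes "finite S" "S \<subseteq> {0<..}"
  shows "card (signed_values S) = 2 * card S"
proof -
  have "- x \<notin> S" if "x \<in> S" for x
    using subsetD[OF assms(2), of x] subsetD[OF assms(2), of "- x"] that by auto
  then have "S \<inter> uminus ` S = {}"
    by auto
  then show ?thesis
    using assms(1) by (simp add: signed_values_def card_Un_disjoint card_image)
qed

lemma finite_labelings:
  assumes "finite V" "finite S" "S \<subseteq> {0<..}"
  shows "finite (labelings V S)"
proof (rule finite_subset)
  show "labelings V S \<subseteq> V \<rightarrow>\<^sub>E signed_values S"
    using assms(3) by (auto simp: labelings_def PiE_def signed_values_iff dest: bij_betw_apply)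
  show "finite (V \<rightarrow>\<^sub>E signed_values S)"
    using assms by (intro finite_PiE) (simp_all add: finite_signed_values)
qed

lemma restrict_in_labelings:
  "bij_betw (\<lambda>u. \<bar>w u\<bar>) V S \<Longrightarrow> restrict w V \<in> labelings V S"
  by (simp add: labelings_def cong: bij_betw_cong)

lemma fun_upd_in_labelings:
  assumes w: "w \<in> labelings (V - {r}) (S - {\<bar>x\<bar>})" and "r \<in> V" "\<bar>x\<bar> \<in> S"
  shows "w(r := x) \<in> labelings V S"
proof -
  from w have "bij_betw (\<lambda>u. \<bar>w u\<bar>) (V - {r}) (S - {\<bar>x\<bar>})"
    by (simp add: labelings_def)
  then have "bij_betw (\<lambda>u. \<bar>(w(r := x)) u\<bar>) (V - {r}) (S - {\<bar>x\<bar>})"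
    by (subst bij_betw_cong[where g = "\<lambda>u. \<bar>w u\<bar>"]) auto
  then have "bij_betw (\<lambda>u. \<bar>(w(r := x)) u\<bar>) (insert r (V - {r})) (insert \<bar>x\<bar> (S - {\<bar>x\<bar>}))"
    using notIn_Un_bij_betw3[of r "V - {r}" "\<lambda>u. \<bar>(w(r := x)) u\<bar>" "S - {\<bar>x\<bar>}"] by simp
  moreover have "w(r := x) \<in> extensional V"
    using assms by (auto simp: labelings_def extensional_def)
  ultimately show ?thesis
    using assms by (simp add: labelings_def insert_absorb)
qed

text \<open>
  Choosing the label of one vertex \<open>r\<close> first, and then labeling the rest with the absolute values
  that are left.
\<close>

lemma sum_labelings_remove:
  fixes f :: "('v \<Rightarrow> int) \<Rightarrow> 'a::comm_monoid_add"
  assumes V: "finite V" "r \<in> V" and S: "finite S" "S \<subseteq> {0<..}"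
  shows "(\<Sum>w\<in>labelings V S. f w) =
    (\<Sum>x\<in>signed_values S. \<Sum>w\<in>labelings (V - {r}) (S - {\<bar>x\<bar>}). f (w(r := x)))"
proof -
  let ?P = "SIGMA x:signed_values S. labelings (V - {r}) (S - {\<bar>x\<bar>})"
  have "(\<Sum>w\<in>labelings V S. f w) = (\<Sum>p\<in>?P. f ((snd p)(r := fst p)))"
  proof (rule sum.reindex_bij_witness
      [where i = "\<lambda>p. (snd p)(r := fst p)" and j = "\<lambda>w. (w r, restrict w (V - {r}))"])
    fix w assume w: "w \<in> labelings V S"
    then have ext: "w \<in> extensional V" and bij: "bij_betw (\<lambda>u. \<bar>w u\<bar>) V S"
      by (auto simp: labelings_def)
    show eq: "(snd (w r, restrict w (V - {r})))(r := fst (w r, restrict w (V - {r}))) = w"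
      using ext V by (auto simp: fun_eq_iff extensional_def)
    show "f ((snd (w r, restrict w (V - {r})))(r := fst (w r, restrict w (V - {r})))) = f w"
      unfolding eq ..
    have wr: "\<bar>w r\<bar> \<in> S"
      using bij_betw_apply[OF bij \<open>r \<in> V\<close>] .
    then have "bij_betw (\<lambda>u. \<bar>w u\<bar>) (V - {r}) (S - {\<bar>w r\<bar>})"
      using bij_betw_DiffI[OF bij bij_betw_singletonI[of "\<lambda>u. \<bar>w u\<bar>" r "\<bar>w r\<bar>"]] V
      by simp
    then have "restrict w (V - {r}) \<in> labelings (V - {r}) (S - {\<bar>w r\<bar>})"
      by (rule restrict_in_labelings)
    moreover have "w r \<in> signed_values S"
      using wr S by (simp add: signed_values_iff)
    ultimately show "(w r, restrict w (V - {r})) \<in> ?P"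
      by simp
  next
    fix p assume p: "p \<in> ?P"
    obtain x w where [simp]: "p = (x, w)" by (cases p)
    from p have x: "\<bar>x\<bar> \<in> S" and w: "w \<in> labelings (V - {r}) (S - {\<bar>x\<bar>})"
      using S by (auto simp: signed_values_iff)
    have "restrict (w(r := x)) (V - {r}) = w"
      using w by (auto simp: labelings_def fun_eq_iff extensional_def)
    then show "(((snd p)(r := fst p)) r, restrict ((snd p)(r := fst p)) (V - {r})) = p"
      by simp
    show "(snd p)(r := fst p) \<in> labelings V S"
      using fun_upd_in_labelings[OF w \<open>r \<in> V\<close> x] by simp
  qed
  also have "\<dots> = (\<Sum>x\<in>signed_values S.
      \<Sum>w\<in>labelings (V - {r}) (S - {\<bar>x\<bar>}). f (w(r := x)))"
  proof -
    have "S - {x} \<subseteq> {0<..}" for x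
      using S by auto
    then show ?thesis
      using V S by (subst sum.Sigma)
        (auto simp: finite_signed_values split_def intro!: finite_labelings)
  qed
  finally show ?thesis .
qed

text \<open>
  Labeling two disjoint parts independently, once it is decided which absolute values go to which part.
\<close>

lemma sum_labelings_union:
  fixes f :: "('v \<Rightarrow> int) \<Rightarrow> 'a::comm_monoid_add"
  assumes fin: "finite A" "finite B" and disj: "A \<inter> B = {}" and S: "finite S" "S \<subseteq> {0<..}"
  shows "(\<Sum>w\<in>labelings (A \<union> B) S. f w) =
    (\<Sum>T | T \<subseteq> S \<and> card T = card A.
      \<Sum>a\<in>labelings A T. \<Sum>b\<in>labelings B (S - T). f (\<lambda>v. if v \<in> A then a v else b v))"
proof -
  let ?T = "{T. T \<subseteq> S \<and> card T = card A}"
  let ?P = "SIGMA T:?T. labelings A T \<times> labelings B (S - T)"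
  let ?m = "\<lambda>(T :: int set, a :: 'v \<Rightarrow> int, b). \<lambda>v. if v \<in> A then a v else b v"
  let ?s = "\<lambda>w. ((\<lambda>u. \<bar>w u\<bar>) ` A, restrict w A, restrict w B)"
  have "(\<Sum>w\<in>labelings (A \<union> B) S. f w) = (\<Sum>p\<in>?P. f (?m p))"
  proof (rule sum.reindex_bij_witness[where i = ?m and j = ?s])
    fix w assume w: "w \<in> labelings (A \<union> B) S"
    then have ext: "w \<in> extensional (A \<union> B)" and bij: "bij_betw (\<lambda>u. \<bar>w u\<bar>) (A \<union> B) S"
      by (auto simp: labelings_def)
    show eq: "?m (?s w) = w"
      using ext by (auto simp: fun_eq_iff extensional_def)
    show "f (?m (?s w)) = f w"
      unfolding eq ..
    let ?T' = "(\<lambda>u. \<bar>w u\<bar>) ` A"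
    have bA: "bij_betw (\<lambda>u. \<bar>w u\<bar>) A ?T'"
      using bij by (auto simp: bij_betw_def intro: inj_on_subset)
    have "A \<union> B - A = B"
      using disj by auto
    moreover have "?T' \<subseteq> S"
      using bij by (auto simp: bij_betw_def)
    ultimately have bB: "bij_betw (\<lambda>u. \<bar>w u\<bar>) B (S - ?T')"
      using bij_betw_DiffI[OF bij bA] by simp
    have "restrict w A \<in> labelings A ?T'" "restrict w B \<in> labelings B (S - ?T')"
      using bA bB by (simp_all only: restrict_in_labelings)
    moreover have "card ?T' = card A"
      using bij_betw_same_card[OF bA] by simp
    ultimately show "?s w \<in> ?P"
      using \<open>?T' \<subseteq> S\<close> by simp
  next
    fix p assume p: "p \<in> ?P"
    obtain T a b where peq [simp]: "p = (T, a, b)" by (cases p)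
    from p have T: "T \<subseteq> S" and ext: "a \<in> extensional A" "b \<in> extensional B"
      and bij: "bij_betw (\<lambda>u. \<bar>a u\<bar>) A T" "bij_betw (\<lambda>u. \<bar>b u\<bar>) B (S - T)"
      by (auto simp: labelings_def)
    let ?w = "\<lambda>v. if v \<in> A then a v else b v"
    have B: "v \<notin> A" if "v \<in> B" for v
      using that disj by auto
    have wA: "bij_betw (\<lambda>u. \<bar>?w u\<bar>) A T"
      using bij(1) by (simp cong: bij_betw_cong)
    have wB: "bij_betw (\<lambda>u. \<bar>?w u\<bar>) B (S - T)"
      using bij(2) B by (simp cong: bij_betw_cong)
    have "restrict ?w A = a" "restrict ?w B = b"
      using ext B by (auto simp: fun_eq_iff extensional_def)
    moreover have "(\<lambda>u. \<bar>?w u\<bar>) ` A = T"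
      using wA by (simp add: bij_betw_def)
    ultimately show "?s (?m p) = p"
      by simp
    have "bij_betw (\<lambda>u. \<bar>?w u\<bar>) (A \<union> B) (T \<union> (S - T))"
      using wA wB by (rule bij_betw_combine) auto
    moreover have "T \<union> (S - T) = S"
      using T by auto
    moreover have "?w \<in> extensional (A \<union> B)"
      using ext by (auto simp: extensional_def)
    ultimately show "?m p \<in> labelings (A \<union> B) S"
      by (simp add: labelings_def)
  qed
  also have "\<dots> = (\<Sum>T\<in>?T. \<Sum>(a, b)\<in>labelings A T \<times> labelings B (S - T). f (?m (T, a, b)))"
  proof -
    have "finite (labelings A T \<times> labelings B (S - T))" if "T \<in> ?T" for T
      using that fin S by (intro finite_cartesian_product finite_labelings) (auto dest: finite_subset)
    then show ?thesis
      using S by (subst sum.Sigma) (auto intro!: sum.cong)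
  qed
  also have "\<dots> = (\<Sum>T\<in>?T. \<Sum>a\<in>labelings A T. \<Sum>b\<in>labelings B (S - T). f (?m (T, a, b)))"
    by (simp add: sum.cartesian_product)
  finally show ?thesis
    by simp
qed

section \<open>Forests as families of subtrees\<close>

text \<open>
  A rooted forest on \<open>V\<close>, encoded by the vertex set \<open>D u\<close> of the subtree at each vertex \<open>u\<close>. Removing
  a root or a whole tree shrinks \<open>V\<close> but leaves all remaining sets \<open>D u\<close> unchanged.
\<close>

locale rooted_forest =
  fixes V :: "'v set" and D :: "'v \<Rightarrow> 'v set"
  assumes finite_V: "finite V"
    and subtree_subset: "u \<in> V \<Longrightarrow> D u \<subseteq> V"
    and self_in_subtree: "u \<in> V \<Longrightarrow> u \<in> D u"
    and subtree_mono: "u \<in> V \<Longrightarrow> v \<in> D u \<Longrightarrow> D v \<subseteq> D u"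
    and subtree_inj: "inj_on D V"
    and subtree_laminar: "u \<in> V \<Longrightarrow> v \<in> V \<Longrightarrow> D u \<inter> D v \<noteq> {} \<Longrightarrow> D u \<subseteq> D v \<or> D v \<subseteq> D u"
begin

lemma rooted_forest_subset:
  assumes "W \<subseteq> V" "\<And>u. u \<in> W \<Longrightarrow> D u \<subseteq> W"
  shows "rooted_forest W D"
proof
  show "finite W"
    using finite_V assms(1) by (rule rev_finite_subset)
  show "inj_on D W"
    using subtree_inj assms(1) by (rule inj_on_subset)
qed (use assms subtree_mono self_in_subtree subtree_laminar in blast)+

end

text \<open>
  The inversions with upper vertex \<open>u\<close>, and then the pairs with negative sum. Since \<open>u \<in> D u\<close>, the
  element \<open>v = u\<close> of the second set records whether the label of \<open>u\<close> is negative.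
\<close>

definition charge :: "('v \<Rightarrow> 'v set) \<Rightarrow> ('v \<Rightarrow> int) \<Rightarrow> 'v \<Rightarrow> nat" where
  "charge D w u = card {v \<in> D u. w u < w v} + card {v \<in> D u. w u < - w v}"

lemma charge_cong:
  assumes "u \<in> D u" "\<And>v. v \<in> D u \<Longrightarrow> w v = w' v"
  shows "charge D w u = charge D w' u"
proof -
  have "{v \<in> D u. w u < w v} = {v \<in> D u. w' u < w' v}"
    "{v \<in> D u. w u < - w v} = {v \<in> D u. w' u < - w' v}"
    using assms by auto
  then show ?thesis
    by (simp add: charge_def)
qed

text \<open>
  Each \<open>v\<close> contributes the two signed values \<open>w v\<close> and \<open>- w v\<close>, in either order of the signs; hence
  the charge of \<open>u\<close> is the rank of its label among all signed values of its subtree.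
\<close>

lemma charge_eq_rank:
  assumes w: "w \<in> labelings (D u) S" and S: "finite S" "S \<subseteq> {0<..}"
  shows "charge D w u = card {x \<in> signed_values S. w u < x}"
proof -
  from w have bij: "bij_betw (\<lambda>u. \<bar>w u\<bar>) (D u) S"
    by (simp add: labelings_def)
  have fin: "finite (D u)"
    using bij S bij_betw_finite by blast
  have nz: "w v \<noteq> 0" if "v \<in> D u" for v
    using bij_betw_apply[OF bij that] S by auto
  have inj: "x = y" if "x \<in> D u" "y \<in> D u" "\<bar>w x\<bar> = \<bar>w y\<bar>" for x y
    using bij that by (auto simp: bij_betw_def inj_on_def)
  have img: "S = (\<lambda>u. \<bar>w u\<bar>) ` D u"
    using bij by (simp add: bij_betw_def)
  have "{x \<in> signed_values S. w u < x} =
      w ` {v \<in> D u. w u < w v} \<union> (\<lambda>v. - w v) ` {v \<in> D u. w u < - w v}" (is "_ = ?P \<union> ?N")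
  proof -
    have "x \<in> signed_values S \<longleftrightarrow> (\<exists>v\<in>D u. x = w v \<or> x = - w v)" for x
      using S by (auto simp: signed_values_iff img abs_eq_iff image_iff)
    then show ?thesis
      by auto
  qed
  moreover have "w x \<noteq> - w y" if "x \<in> D u" "y \<in> D u" for x y
    using inj[OF that] nz[OF that(1)] by auto
  then have "?P \<inter> ?N = {}"
    by auto
  moreover have "card ?P = card {v \<in> D u. w u < w v}"
    using inj by (intro card_image) (auto simp: inj_on_def)
  moreover have "card ?N = card {v \<in> D u. w u < - w v}"
    using inj by (intro card_image) (auto simp: inj_on_def)
  ultimately show ?thesis
    using fin by (simp add: charge_def card_Un_disjoint)
qed

section \<open>The generating function of the total charge\<close>

text \<open>
  Stated with the hook lengths multiplied out, the formula needs no division. The induction removes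
  the root if there is only one tree, and otherwise splits off a tree with the largest number of
  vertices; by laminarity a maximal subtree meets no subtree outside it.
\<close>

theorem charge_generating_function:
  fixes q :: "'a::comm_semiring_1"
  assumes "rooted_forest V D" "finite S" "S \<subseteq> {0<..}" "card S = card V"
  shows "(\<Sum>w\<in>labelings V S. q ^ (\<Sum>u\<in>V. charge D w u)) * (\<Prod>u\<in>V. of_nat (card (D u))) =
    of_nat (fact (card V)) * (\<Prod>u\<in>V. q_int q (2 * card (D u)))"
  using assms
proof (induction "card V" arbitrary: V S rule: less_induct)
  case less
  interpret rooted_forest V D by fact
  note S = \<open>finite S\<close> \<open>S \<subseteq> {0<..}\<close>
  let ?G = "\<lambda>V S. \<Sum>w\<in>labelings V S. q ^ (\<Sum>u\<in>V. charge D w u)"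
  let ?h = "\<lambda>V. \<Prod>u\<in>V. of_nat (card (D u)) :: 'a"
  let ?Q = "\<lambda>V. \<Prod>u\<in>V. q_int q (2 * card (D u))"
  consider "V = {}" | r where "r \<in> V" "D r = V" | "V \<noteq> {}" "\<And>r. r \<in> V \<Longrightarrow> D r \<noteq> V"
    by blast
  then show ?case
  proof cases
    case 1
    then have "labelings V S = {\<lambda>_. undefined}"
      using less.prems(2,4) by (auto simp: labelings_def bij_betw_def)
    with 1 show ?thesis
      by simp
  next
    case (2 r)
    let ?V = "V - {r}"
    have sub: "D u \<subseteq> ?V" if u: "u \<in> ?V" for u
    proof -
      have "D u = D r" if "r \<in> D u"
        using that u subtree_mono[of u r] subtree_subset[of u] 2 by auto
      then show ?thesis
        using u 2 subtree_inj subtree_subset[of u] by (auto dest: inj_onD)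
    qed
    have V: "rooted_forest ?V D"
      using sub by (intro rooted_forest_subset) auto
    have card_V: "card V = Suc (card ?V)"
      using card_Suc_Diff1[OF finite_V \<open>r \<in> V\<close>] by simp
    have weight: "(\<Sum>u\<in>V. charge D (w(r := x)) u) =
        card {y \<in> signed_values S. x < y} + (\<Sum>u\<in>?V. charge D w u)"
      if x: "x \<in> signed_values S" and w: "w \<in> labelings ?V (S - {\<bar>x\<bar>})" for x w
    proof -
      have "w(r := x) \<in> labelings (D r) S"
        using fun_upd_in_labelings[OF w \<open>r \<in> V\<close>] x S 2 by (simp add: signed_values_iff)
      then have "charge D (w(r := x)) r = card {y \<in> signed_values S. x < y}"
        using S by (simp add: charge_eq_rank)
      moreover have "charge D (w(r := x)) u = charge D w u" if "u \<in> ?V" for u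
        using that sub[OF that] self_in_subtree by (intro charge_cong) auto
      ultimately show ?thesis
        by (simp add: sum.remove[OF finite_V \<open>r \<in> V\<close>])
    qed
    have IH: "?G ?V (S - {\<bar>x\<bar>}) * ?h ?V = of_nat (fact (card ?V)) * ?Q ?V"
      if "x \<in> signed_values S" for x
    proof (rule less.hyps)
      show "card (S - {\<bar>x\<bar>}) = card ?V"
        using that S less.prems(4) card_V by (simp add: signed_values_iff)
    qed (use card_V V S in auto)
    have "?G V S = (\<Sum>x\<in>signed_values S. \<Sum>w\<in>labelings ?V (S - {\<bar>x\<bar>}).
        q ^ (\<Sum>u\<in>V. charge D (w(r := x)) u))"
      by (rule sum_labelings_remove[OF finite_V \<open>r \<in> V\<close> S])
    also have "\<dots> = (\<Sum>x\<in>signed_values S.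
        q ^ card {y \<in> signed_values S. x < y} * ?G ?V (S - {\<bar>x\<bar>}))"
      by (simp add: weight power_add sum_distrib_left)
    finally have "?G V S * ?h ?V = (\<Sum>x\<in>signed_values S.
        q ^ card {y \<in> signed_values S. x < y} * (?G ?V (S - {\<bar>x\<bar>}) * ?h ?V))"
      by (simp add: sum_distrib_right mult.assoc)
    also have "\<dots> = (\<Sum>x\<in>signed_values S.
        q ^ card {y \<in> signed_values S. x < y} * (of_nat (fact (card ?V)) * ?Q ?V))"
      by (intro sum.cong refl) (simp only: IH)
    also have "\<dots> = q_int q (2 * card V) * (of_nat (fact (card ?V)) * ?Q ?V)"
      using sum_power_rank[OF finite_signed_values[OF S(1)], of q] card_signed_values[OF S] less.prems(4)
      by (simp flip: sum_distrib_right)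
    finally have *: "?G V S * ?h ?V = q_int q (2 * card V) * (of_nat (fact (card ?V)) * ?Q ?V)" .
    have h: "?h V = of_nat (card V) * ?h ?V" and Q: "?Q V = q_int q (2 * card V) * ?Q ?V"
      using 2 by (simp_all add: prod.remove[OF finite_V \<open>r \<in> V\<close>])
    have fact_V: "of_nat (fact (card V)) = (of_nat (card V) * of_nat (fact (card ?V)) :: 'a)"
      unfolding card_V by (simp only: fact_Suc of_nat_mult of_nat_id)
    have "?G V S * ?h V = of_nat (card V) * (?G V S * ?h ?V)"
      unfolding h by (rule mult.left_commute)
    also have "\<dots> = of_nat (fact (card V)) * ?Q V"
      unfolding * Q fact_V by (simp only: mult_ac)
    finally show ?thesis .
  next
    case 3
    have "Max ((\<lambda>u. card (D u)) ` V) \<in> (\<lambda>u. card (D u)) ` V"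
      using finite_V 3(1) by (intro Max_in) auto
    then obtain r where r: "r \<in> V" and r_max: "Max ((\<lambda>u. card (D u)) ` V) = card (D r)"
      by blast
    have max: "card (D u) \<le> card (D r)" if "u \<in> V" for u
      using that finite_V by (simp flip: r_max)
    define A where "A = D r"
    define B where "B = V - A"
    have AV: "A \<subseteq> V" and rA: "r \<in> A"
      using r subtree_subset self_in_subtree by (auto simp: A_def)
    have finA: "finite A" and finB: "finite B"
      using finite_V AV by (auto simp: B_def intro: finite_subset)
    have V_eq: "V = A \<union> B" and disj: "A \<inter> B = {}"
      using AV by (auto simp: B_def)
    have subA: "D u \<subseteq> A" if "u \<in> A" for u
      using that r subtree_mono by (simp add: A_def)
    have subB: "D u \<subseteq> B" if u: "u \<in> B" for u
    proof -
      have uV: "u \<in> V" and "u \<notin> A"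
        using u by (auto simp: B_def)
      have "\<not> D u \<subseteq> A"
        using \<open>u \<notin> A\<close> self_in_subtree[OF uV] by auto
      moreover have "\<not> A \<subseteq> D u"
        \<comment> \<open>The inclusion would be an equality because \<open>A\<close> is a subtree of maximal cardinality.\<close>
        using calculation max[OF uV] card_seteq[of "D u" A] finite_subset[OF subtree_subset[OF uV] finite_V]
        by (auto simp: A_def)
      ultimately have "D u \<inter> A = {}"
        using subtree_laminar[OF uV r] by (auto simp: A_def)
      then show ?thesis
        using subtree_subset[OF uV] by (auto simp: B_def)
    qed
    have A: "rooted_forest A D" and B: "rooted_forest B D"
      using subA subB AV by (auto intro!: rooted_forest_subset simp: B_def)
    have card_V: "card V = card A + card B"
      using card_Un_disjoint[OF finA finB disj] V_eq by simp
    have "A \<noteq> V"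
      using 3 r by (auto simp: A_def)
    then have "card A < card V"
      using AV finite_V by (simp add: psubset_card_mono psubset_eq)
    have "card B < card V"
      using rA finA card_V by (auto simp: card_gt_0_iff)
    let ?T = "{T. T \<subseteq> S \<and> card T = card A}"
    have weight: "(\<Sum>u\<in>V. charge D (\<lambda>v. if v \<in> A then a v else b v) u) =
        (\<Sum>u\<in>A. charge D a u) + (\<Sum>u\<in>B. charge D b u)" for a b
    proof -
      have "charge D (\<lambda>v. if v \<in> A then a v else b v) u = charge D a u" if "u \<in> A" for u
        using subA[OF that] that self_in_subtree AV by (intro charge_cong) auto
      moreover have "charge D (\<lambda>v. if v \<in> A then a v else b v) u = charge D b u" if "u \<in> B" for u
        using subB[OF that] that self_in_subtree disj by (intro charge_cong) (auto simp: B_def)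
      ultimately show ?thesis
        unfolding V_eq using finA finB disj by (simp add: sum.union_disjoint)
    qed
    have "?G V S = (\<Sum>T\<in>?T. \<Sum>a\<in>labelings A T. \<Sum>b\<in>labelings B (S - T).
        q ^ (\<Sum>u\<in>V. charge D (\<lambda>v. if v \<in> A then a v else b v) u))"
      using sum_labelings_union[OF finA finB disj S,
          of "\<lambda>w. q ^ (\<Sum>u\<in>V. charge D w u)"] by (simp only: V_eq)
    also have "\<dots> = (\<Sum>T\<in>?T. ?G A T * ?G B (S - T))"
      by (simp only: weight power_add sum_product)
    finally have "?G V S * (?h A * ?h B) = (\<Sum>T\<in>?T. ?G A T * ?G B (S - T)) * (?h A * ?h B)"
      by (rule arg_cong)
    also have "\<dots> = (\<Sum>T\<in>?T. (?G A T * ?h A) * (?G B (S - T) * ?h B))"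
      by (subst sum_distrib_right) (simp only: mult_ac)
    also have "\<dots> = (\<Sum>T\<in>?T. (of_nat (fact (card A)) * ?Q A) * (of_nat (fact (card B)) * ?Q B))"
    proof (rule sum.cong)
      fix T assume "T \<in> ?T"
      then have T: "T \<subseteq> S" "card T = card A" "finite T"
        using S by (auto intro: finite_subset)
      have "card (S - T) = card B"
        using T less.prems(4) card_V by (simp add: card_Diff_subset)
      then have "?G B (S - T) * ?h B = of_nat (fact (card B)) * ?Q B"
        using \<open>card B < card V\<close> B S by (intro less.hyps) auto
      moreover have "?G A T * ?h A = of_nat (fact (card A)) * ?Q A"
        using \<open>card A < card V\<close> A S T by (intro less.hyps) auto
      ultimately show "(?G A T * ?h A) * (?G B (S - T) * ?h B) =
          (of_nat (fact (card A)) * ?Q A) * (of_nat (fact (card B)) * ?Q B)"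
        by (simp only:)
    qed simp
    also have "\<dots> = of_nat ((card V choose card A) * fact (card A) * fact (card B)) * (?Q A * ?Q B)"
      using n_subsets[OF S(1), of "card A"] less.prems(4) by (simp add: mult_ac)
    also have "(card V choose card A) * fact (card A) * fact (card B) = fact (card V)"
      using binomial_fact_lemma[of "card A" "card V"] card_V by (simp add: mult_ac)
    also have "?h A * ?h B = ?h V"
      using finA finB disj by (simp add: V_eq prod.union_disjoint)
    also have "?Q A * ?Q B = ?Q V"
      using finA finB disj by (simp add: V_eq prod.union_disjoint)
    finally show ?thesis .
  qed
qed

section \<open>Plane forests\<close>

definition subtree_vertices :: "plane_forest \<Rightarrow> nat list \<Rightarrow> nat list set" where
  "subtree_vertices F u = {v \<in> vertices F. prefix u v}"

text \<open>
  Subtrees are laminar because two prefixes of the same address are comparable.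
\<close>

lemma rooted_forest_vertices: "rooted_forest (vertices F) (subtree_vertices F)"
proof
  show "inj_on (subtree_vertices F) (vertices F)"
    by (rule inj_onI) (auto simp: subtree_vertices_def set_eq_iff intro: prefix_order.antisym)
next
  fix u v
  assume "subtree_vertices F u \<inter> subtree_vertices F v \<noteq> {}"
  then have "prefix u v \<or> prefix v u"
    by (auto simp: subtree_vertices_def dest: prefix_same_cases)
  then show "subtree_vertices F u \<subseteq> subtree_vertices F v \<or> subtree_vertices F v \<subseteq> subtree_vertices F u"
    by (auto simp: subtree_vertices_def intro: prefix_order.trans)
qed (auto simp: subtree_vertices_def finite_vertices intro: prefix_order.trans)

lemma hook_length_eq: "u \<in> vertices F \<Longrightarrow> hook_length F u = card (subtree_vertices F u)"
  by (simp add: hook_length_def subtree_vertices_def forest_le_def)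

lemma signed_labelings_eq:
  "signed_labelings F = labelings (vertices F) {1..int (forest_size F)}"
proof -
  have "w u \<in> {- int n..int n} - {0}" if "\<bar>w u\<bar> \<in> {1..int n}" for w :: "nat list \<Rightarrow> int" and u n
    using that by auto
  then show ?thesis
    unfolding signed_labelings_def labelings_def PiE_def
    by (auto dest: bij_betw_apply)
qed

text \<open>
  Group all pairs by their upper vertex. In \<open>n2_stat\<close> the upper vertex is the second component,
  which is why the pairs are swapped; the negative labels supply the diagonal \<open>v = u\<close>.
\<close>

lemma invB_stat_eq_sum_charge:
  "invB_stat F w = (\<Sum>u\<in>vertices F. charge (subtree_vertices F) w u)"
proof -
  let ?V = "vertices F" and ?D = "subtree_vertices F"
  have fin: "finite (?D u)" for u
    by (simp add: subtree_vertices_def finite_vertices)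
  have "{(u, v). forest_less F v u \<and> w u < w v} = (SIGMA u:?V. {v \<in> ?D u. w u < w v})"
    by (auto simp: forest_less_def forest_le_def subtree_vertices_def)
  then have inv: "inv_stat F w = (\<Sum>u\<in>?V. card {v \<in> ?D u. w u < w v})"
    by (simp add: inv_stat_def finite_vertices fin)
  have "{(u, v). forest_less F u v \<and> w u + w v < 0} =
      prod.swap ` (SIGMA u:?V. {v \<in> ?D u - {u}. w u < - w v})"
    by (auto simp: forest_less_def forest_le_def subtree_vertices_def image_iff)
  then have n2: "n2_stat F w = (\<Sum>u\<in>?V. card {v \<in> ?D u - {u}. w u < - w v})"
    by (simp add: n2_stat_def finite_vertices fin card_image)
  have n1: "n1_stat F w = (\<Sum>u\<in>?V. if w u < 0 then 1 else 0)"
    by (simp add: n1_stat_def finite_vertices flip: sum.inter_filter)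
  have "(if w u < 0 then 1 else 0) + card {v \<in> ?D u - {u}. w u < - w v} =
      card {v \<in> ?D u. w u < - w v}" if "u \<in> ?V" for u
  proof -
    have "{v \<in> ?D u. w u < - w v} =
        (if w u < 0 then insert u {v \<in> ?D u - {u}. w u < - w v} else {v \<in> ?D u - {u}. w u < - w v})"
      using that by (auto simp: subtree_vertices_def)
    then show ?thesis
      using fin by simp
  qed
  then have "n1_stat F w + n2_stat F w = (\<Sum>u\<in>?V. card {v \<in> ?D u. w u < - w v})"
    unfolding n1 n2 by (simp flip: sum.distrib)
  then show ?thesis
    by (simp add: invB_stat_def inv charge_def sum.distrib)
qed

theorem theorem2p1:
  fixes F :: plane_forest and n :: nat and q :: "'a::field_char_0"
  assumes "forest_size F = n"
  shows "(\<Sum>w\<in>signed_labelings F. q ^ invB_stat F w) =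
    fact n / (\<Prod>u\<in>vertices F. of_nat (hook_length F u)) *
      (\<Prod>u\<in>vertices F. q_int q (2 * hook_length F u))"
proof -
  interpret rooted_forest "vertices F" "subtree_vertices F"
    by (rule rooted_forest_vertices)
  let ?h = "\<Prod>u\<in>vertices F. of_nat (hook_length F u) :: 'a"
  have n: "card (vertices F) = n"
    using assms by (simp add: forest_size_def)
  have "(\<Sum>w\<in>signed_labelings F. q ^ invB_stat F w) * ?h =
      fact n * (\<Prod>u\<in>vertices F. q_int q (2 * hook_length F u))"
    using charge_generating_function[OF rooted_forest_vertices, of "{1..int n}" F q] n assms
    by (simp add: subset_iff signed_labelings_eq invB_stat_eq_sum_charge hook_length_eq)
  moreover have "?h \<noteq> 0"
    using finite_V self_in_subtree subtree_subset
    by (auto simp: hook_length_eq card_eq_0_iff dest: finite_subset)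
  ultimately show ?thesis
    by (simp add: field_simps)
qed

end
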